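(* Let $U$ be a subset of $F^1_{USCG}(X)$. Then $U$ is totally bounded in $(F^1_{USCG}(X), H_{\rm end})$ if and only if $U(\alpha)$ is totally bounded in $(X,d)$ for each $\alpha\in(0,1]$.
   Context: $(X,d)$ is a nonempty metric space. $X\times[0,1]$ carries the metric $\overline d((x,\alpha),(y,\beta))=d(x,y)+|\alpha-\beta|$. A fuzzy set in $X$ is a function $u:X\to[0,1]$. Its $\alpha$-cuts are $[u]_\alpha=\{x\in X: u(x)\ge\alpha\}$ for $\alpha\in(0,1]$ and $[u]_0=\overline{\{x\in X:u(x)>0\}}$ (closure in $X$). $C(Y)$ and $K(Y)$ denote the sets of nonempty closed, respectively nonempty compact, subsets of a metric space $Y$. $F^1_{USC}(X)$ is the set of fuzzy sets $u$ in $X$ with $[u]_\alpha\in C(X)$ for all $\alpha\in[0,1]$; $F^1_{USCG}(X)$ is the set of $u\in F^1_{USC}(X)$ with $[u]_\alpha\in K(X)$ for all $\alpha\in(0,1]$. For nonempty closed sets $A,B$, $H^*(A,B)=\sup_{a\in A}\inf_{b\in B}\rho(a,b)$ and $H(A,B)=\max\{H^*(A,B),H^*(B,A)\}$ is the Hausdorff distance, where $\rho$ is the underlying metric ($d$ on $X$, $\overline d$ on $X\times[0,1]$). The endograph is ${\rm end}\,u=\{(x,t)\in X\times[0,1]:u(x)\ge t\}$, and $H_{\rm end}(u,v)=H({\rm end}\,u,{\rm end}\,v)$ (computed with $\overline d$), which is a metric on $F^1_{USC}(X)$. For a set $U$ of fuzzy sets, $U(\alpha)=\bigcup_{u\in U}[u]_\alpha$.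 *)

theory Defs
  imports "HOL-Analysis.Analysis"
begin

text \<open>The metric space \<open>X\<close> is an arbitrary type of class \<^class>\<open>metric_space\<close>; a fuzzy
  set in it is a function \<open>u\<close> into \<^typ>\<open>real\<close> with values in \<open>[0,1]\<close>. The range condition is
  part of the definition of the set \<open>F1_USC\<close> below.\<close>

definition fcut :: "('a::metric_space \<Rightarrow> real) \<Rightarrow> real \<Rightarrow> 'a set" where
  "fcut u \<alpha> = (if \<alpha> = 0 then closure {x. 0 < u x} else {x. \<alpha> \<le> u x})"

definition F1_USC :: "('a::metric_space \<Rightarrow> real) set" where
  "F1_USC = {u. (\<forall>x. u x \<in> {0..1}) \<and> (\<forall>\<alpha>\<in>{0..1}. closed (fcut u \<alpha>) \<and> fcut u \<alpha> \<noteq> {})}"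

definition F1_USCG :: "('a::metric_space \<Rightarrow> real) set" where
  "F1_USCG = {u \<in> F1_USC. \<forall>\<alpha>\<in>{0<..1}. compact (fcut u \<alpha>) \<and> fcut u \<alpha> \<noteq> {}}"

definition cut_union :: "('a::metric_space \<Rightarrow> real) set \<Rightarrow> real \<Rightarrow> 'a set" where
  "cut_union U \<alpha> = (\<Union>u\<in>U. fcut u \<alpha>)"

text \<open>The library metric on products is the Euclidean combination of the two distances,
  so the sum metric on \<open>X \<times> [0,1]\<close> is introduced separately.\<close>

definition sum_dist :: "'a::metric_space \<times> real \<Rightarrow> 'a \<times> real \<Rightarrow> real" where
  "sum_dist p q = dist (fst p) (fst q) + \<bar>snd p - snd q\<bar>"

text \<open>The Hausdorff distance of closed sets may be infinite, hence the extended real values.\<close>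

definition hausdorff_pre :: "('b \<Rightarrow> 'b \<Rightarrow> real) \<Rightarrow> 'b set \<Rightarrow> 'b set \<Rightarrow> ereal" where
  "hausdorff_pre \<rho> A B = (SUP a\<in>A. INF b\<in>B. ereal (\<rho> a b))"

definition hausdorff :: "('b \<Rightarrow> 'b \<Rightarrow> real) \<Rightarrow> 'b set \<Rightarrow> 'b set \<Rightarrow> ereal" where
  "hausdorff \<rho> A B = max (hausdorff_pre \<rho> A B) (hausdorff_pre \<rho> B A)"

definition endograph :: "('a::metric_space \<Rightarrow> real) \<Rightarrow> ('a \<times> real) set" where
  "endograph u = {(x, t). t \<in> {0..1} \<and> t \<le> u x}"

text \<open>For fuzzy sets the Hausdorff distance of the endographs lies in \<open>[0,1]\<close> (lemma
  \<open>hausdorff_endograph_bounds\<close>), so nothing is lost by the conversion to \<^typ>\<open>real\<close>.\<close>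

definition H_end :: "('a::metric_space \<Rightarrow> real) \<Rightarrow> ('a \<Rightarrow> real) \<Rightarrow> real" where
  "H_end u v = real_of_ereal (hausdorff sum_dist (endograph u) (endograph v))"

lemma hausdorff_pre_endograph_bounds:
  fixes u v :: "'a::metric_space \<Rightarrow> real"
  assumes "\<And>x. 0 \<le> u x" "\<And>x. 0 \<le> v x"
  shows "0 \<le> hausdorff_pre sum_dist (endograph u) (endograph v)"
    and "hausdorff_pre sum_dist (endograph u) (endograph v) \<le> 1"
proof -
  obtain x0 :: 'a where True by simp
  have "(x0, 0) \<in> endograph u"
    using assms by (simp add: endograph_def)
  moreover have "0 \<le> (INF q\<in>endograph v. ereal (sum_dist (x0, 0) q))"
    by (intro INF_greatest) (simp add: sum_dist_def)
  ultimately show "0 \<le> hausdorff_pre sum_dist (endograph u) (endograph v)"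
    unfolding hausdorff_pre_def by (rule SUP_upper2)
  show "hausdorff_pre sum_dist (endograph u) (endograph v) \<le> 1"
    unfolding hausdorff_pre_def
  proof (rule SUP_least)
    fix p assume "p \<in> endograph u"
    then have "ereal (sum_dist p (fst p, 0)) \<le> 1"
      by (auto simp: endograph_def sum_dist_def one_ereal_def)
    moreover have "(fst p, 0) \<in> endograph v"
      using assms by (simp add: endograph_def)
    ultimately show "(INF q\<in>endograph v. ereal (sum_dist p q)) \<le> 1"
      by (metis INF_lower2)
  qed
qed

lemma hausdorff_endograph_bounds:
  fixes u v :: "'a::metric_space \<Rightarrow> real"
  assumes "\<And>x. 0 \<le> u x" "\<And>x. 0 \<le> v x"
  shows "0 \<le> hausdorff sum_dist (endograph u) (endograph v)"
    and "hausdorff sum_dist (endograph u) (endograph v) \<le> 1"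
  using hausdorff_pre_endograph_bounds[of u v] hausdorff_pre_endograph_bounds[of v u] assms
  by (auto simp: hausdorff_def le_max_iff_disj)

lemma F1_USC_range: "u \<in> F1_USC \<Longrightarrow> 0 \<le> u x" "u \<in> F1_USC \<Longrightarrow> u x \<le> 1"
  by (auto simp: F1_USC_def)

lemma ereal_H_end:
  assumes "u \<in> F1_USC" "v \<in> F1_USC"
  shows "ereal (H_end u v) = hausdorff sum_dist (endograph u) (endograph v)"
proof -
  have "\<bar>hausdorff sum_dist (endograph u) (endograph v)\<bar> \<noteq> \<infinity>"
    using hausdorff_endograph_bounds[of u v] F1_USC_range assms by fastforce
  then show ?thesis
    by (simp add: H_end_def ereal_real)
qed

lemma H_end_commute: "H_end u v = H_end v u"
  by (simp add: H_end_def hausdorff_def max.commute)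

lemma H_end_nonneg: "0 \<le> H_end u v"
proof -
  have pre: "hausdorff_pre sum_dist A B \<ge> 0 \<or> hausdorff_pre sum_dist A B = - \<infinity>"
    for A B :: "('a \<times> real) set"
  proof (cases "A = {}")
    case True
    then show ?thesis
      by (simp add: hausdorff_pre_def bot_ereal_def)
  next
    case False
    then obtain a where "a \<in> A" by blast
    moreover have "0 \<le> (INF b\<in>B. ereal (sum_dist a b))"
      by (intro INF_greatest) (simp add: sum_dist_def)
    ultimately show ?thesis
      unfolding hausdorff_pre_def by (blast intro: SUP_upper2)
  qed
  have "hausdorff sum_dist (endograph u) (endograph v) \<ge> 0
      \<or> hausdorff sum_dist (endograph u) (endograph v) = - \<infinity>"
    using pre[of "endograph u" "endograph v"] pre[of "endograph v" "endograph u"]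
    by (auto simp: hausdorff_def max_def)
  then show ?thesis
    by (auto simp: H_end_def intro: real_of_ereal_pos)
qed

lemma H_end_less_imp:
  assumes "u \<in> F1_USC" "v \<in> F1_USC" "H_end u v < r" "p \<in> endograph u"
  shows "\<exists>q\<in>endograph v. sum_dist p q < r"
proof -
  have "(INF q\<in>endograph v. ereal (sum_dist p q))
      \<le> hausdorff_pre sum_dist (endograph u) (endograph v)"
    unfolding hausdorff_pre_def using assms(4) by (intro SUP_upper)
  also have "\<dots> \<le> ereal (H_end u v)"
    using assms by (simp add: ereal_H_end hausdorff_def)
  also have "\<dots> < ereal r"
    using assms by simp
  finally show ?thesis
    by (auto simp: INF_less_iff)
qed

lemma H_end_le:
  assumes "u \<in> F1_USC" "v \<in> F1_USC"
    and "\<And>p. p \<in> endograph u \<Longrightarrow> \<exists>q\<in>endograph v. sum_dist p q \<le> r"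
    and "\<And>p. p \<in> endograph v \<Longrightarrow> \<exists>q\<in>endograph u. sum_dist p q \<le> r"
  shows "H_end u v \<le> r"
proof -
  have "hausdorff sum_dist (endograph u) (endograph v) \<le> ereal r"
    unfolding hausdorff_def hausdorff_pre_def
    using assms(3,4) by (auto intro!: SUP_least) (metis INF_lower2 ereal_less_eq(3))+
  then show ?thesis
    using assms by (simp flip: ereal_H_end)
qed

lemma sum_dist_triangle: "sum_dist p r \<le> sum_dist p q + sum_dist q r"
  unfolding sum_dist_def using dist_triangle[of "fst p" "fst r" "fst q"] by linarith

lemma H_end_triangle:
  assumes "u \<in> F1_USC" "v \<in> F1_USC" "w \<in> F1_USC"
  shows "H_end u w \<le> H_end u v + H_end v w"
proof (rule field_le_epsilon)
  have *: "\<exists>q\<in>endograph w. sum_dist p q \<le> H_end u v + H_end v w + e"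
    if asm: "u \<in> F1_USC" "v \<in> F1_USC" "w \<in> F1_USC" "p \<in> endograph u" "0 < e"
    for u v w :: "'a \<Rightarrow> real" and p e
  proof -
    obtain q where q: "q \<in> endograph v" "sum_dist p q < H_end u v + e / 2"
      using H_end_less_imp[of u v "H_end u v + e / 2" p] asm by auto
    obtain s where s: "s \<in> endograph w" "sum_dist q s < H_end v w + e / 2"
      using H_end_less_imp[of v w "H_end v w + e / 2" q] asm q by auto
    show ?thesis
      using q s sum_dist_triangle[of p s q] by (intro bexI[of _ s]) auto
  qed
  fix e :: real assume "0 < e"
  show "H_end u w \<le> H_end u v + H_end v w + e"
  proof (rule H_end_le[OF assms(1,3)])
    show "\<exists>q\<in>endograph w. sum_dist p q \<le> H_end u v + H_end v w + e"
      if "p \<in> endograph u" for p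
      using *[of u v w p e] that assms \<open>0 < e\<close> by blast
    show "\<exists>q\<in>endograph u. sum_dist p q \<le> H_end u v + H_end v w + e"
      if "p \<in> endograph w" for p
      using *[of w v u p e] that assms \<open>0 < e\<close> by (simp add: H_end_commute add.commute)
  qed
qed

lemma H_end_zero_imp_le:
  assumes u: "u \<in> F1_USC" and v: "v \<in> F1_USC" and 0: "H_end u v = 0"
  shows "u x \<le> v x"
proof (rule dense_le)
  fix s assume s: "s < u x"
  show "s \<le> v x"
  proof (cases "s > 0")
    case False
    then show ?thesis
      using F1_USC_range(1)[OF v, of x] by linarith
  next
    case True
    have "s \<le> 1"
      using s F1_USC_range(2)[OF u, of x] by linarith
    have cut: "fcut v s = {y. s \<le> v y}"
      using True by (simp add: fcut_def)
    have "x \<in> closure (fcut v s)"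
      unfolding closure_approachable
    proof (intro allI impI)
      fix e :: real assume "0 < e"
      have "(x, u x) \<in> endograph u"
        using F1_USC_range[OF u] by (simp add: endograph_def)
      moreover have "H_end u v < min e (u x - s)"
        using \<open>0 < e\<close> s 0 by simp
      ultimately obtain q where q: "q \<in> endograph v" "sum_dist (x, u x) q < min e (u x - s)"
        using H_end_less_imp[OF u v] by blast
      then have "s \<le> v (fst q)" "dist (fst q) x < e"
        by (auto simp: sum_dist_def endograph_def dist_commute) (smt (verit) zero_le_dist)+
      then show "\<exists>y\<in>fcut v s. dist y x < e"
        using cut by blast
    qed
    moreover have "closed (fcut v s)"
      using v True \<open>s \<le> 1\<close> by (simp add: F1_USC_def)
    ultimately show ?thesis
      using cut by simp
  qed
qed

lemma H_end_self: "u \<in> F1_USC \<Longrightarrow> H_end u u = 0"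
  by (intro antisym H_end_nonneg H_end_le) (auto simp: sum_dist_def intro!: bexI)

lemma Metric_space_F1_USC: "Metric_space F1_USC H_end"
proof
  fix u v :: "'a \<Rightarrow> real"
  assume "u \<in> F1_USC" "v \<in> F1_USC"
  then show "H_end u v = 0 \<longleftrightarrow> u = v"
    by (metis H_end_commute H_end_self H_end_zero_imp_le antisym ext)
qed (use H_end_nonneg H_end_commute H_end_triangle in blast)+

lemma Metric_space_F1_USCG: "Metric_space F1_USCG H_end"
  by (rule Metric_space.subspace[OF Metric_space_F1_USC]) (auto simp: F1_USCG_def)

end

theory Submission imports Defs begin

text \<open>Both directions compare endographs with \<alpha>-cuts. If the endographs of \<open>u\<close> and \<open>v\<close> are
  closer than \<open>\<delta>\<close>, then every point of \<open>[u]\<^sub>\<alpha>\<close> is within \<open>\<delta>\<close> of \<open>[v]\<^sub>\<beta>\<close> as soon as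
  \<open>0 < \<beta> \<le> \<alpha> - \<delta>\<close> (\<open>H_end_less_imp_near_cut\<close>). So a finite net of \<open>U\<close> yields finitely many compact
  cuts at level \<open>\<alpha>/2\<close> whose union approximates \<open>U(\<alpha>)\<close>, and a set approximated arbitrarily well by
  totally bounded sets is totally bounded.

  Conversely, the endograph of \<open>u\<close> is known up to a small error from finitely many bits: slice the
  unit interval at the levels \<open>k/N\<close> and record which of the balls around a finite net of
  \<open>U(1/N)\<close> meet each cut \<open>[u]\<^bsub>k/N\<^esub>\<close>. Heights below \<open>1/N\<close> need no information, because all
  endographs contain the base \<open>X \<times> {0}\<close>; this is why only cuts at positive levels occur in the
  criterion. There are finitely many such records, and two fuzzy sets with the same record are close
  (\<open>H_end_le_if_fingerprint_eq\<close>), so one representative for each record is a finite net of \<open>U\<close>.\<close>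

section \<open>Total boundedness\<close>

lemma compact_imp_totally_bounded:
  fixes S :: "'a::metric_space set"
  assumes "compact S"
  shows "totally_bounded S"
  using assms by (simp add: compact_eq_totally_bounded totally_bounded_metric ball_def)

lemma totally_bounded_if_approximated:
  fixes S :: "'a::metric_space set"
  assumes "\<And>e. 0 < e \<Longrightarrow> \<exists>T. totally_bounded T \<and> (\<forall>x\<in>S. \<exists>y\<in>T. dist x y < e)"
  shows "totally_bounded S"
  unfolding totally_bounded_metric
proof (intro allI impI)
  fix e :: real assume "0 < e"
  then obtain T where T: "totally_bounded T" "\<And>x. x \<in> S \<Longrightarrow> \<exists>y\<in>T. dist x y < e / 2"
    using assms[of "e / 2"] by auto
  from T(1) \<open>0 < e\<close> obtain F where F: "finite F" "T \<subseteq> (\<Union>z\<in>F. {y. dist z y < e / 2})"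
    unfolding totally_bounded_metric using half_gt_zero by blast
  have "\<exists>z\<in>F. dist z x < e" if x: "x \<in> S" for x
  proof -
    obtain y where y: "y \<in> T" "dist x y < e / 2"
      using T(2) x by blast
    then obtain z where "z \<in> F" "dist z y < e / 2"
      using F(2) by blast
    then show ?thesis
      using y dist_triangle_half_r[of y z e x] by (auto simp: dist_commute)
  qed
  then show "\<exists>F. finite F \<and> S \<subseteq> (\<Union>z\<in>F. {x. dist z x < e})"
    using F(1) by (intro exI[of _ F]) auto
qed

text \<open>One representative for each value of \<open>f\<close> forms a finite net. The net lies in \<open>S\<close> itself,
  as the definition of \<open>mtotally_bounded\<close> demands.\<close>

lemma (in Metric_space) mtotally_bounded_if_finite_invariant:
  assumes "S \<subseteq> M"
    and inv: "\<And>e. 0 < e \<Longrightarrow>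
      \<exists>f :: 'a \<Rightarrow> 'c. finite (f ` S) \<and> (\<forall>x\<in>S. \<forall>y\<in>S. f x = f y \<longrightarrow> d x y < e)"
  shows "mtotally_bounded S"
  unfolding mtotally_bounded_def
proof (intro allI impI)
  fix e :: real assume "0 < e"
  then obtain f :: "'a \<Rightarrow> 'c" where f: "finite (f ` S)"
    "\<And>x y. x \<in> S \<Longrightarrow> y \<in> S \<Longrightarrow> f x = f y \<Longrightarrow> d x y < e"
    using inv[of e] by auto
  define K where "K = inv_into S f ` f ` S"
  have "K \<subseteq> S"
    unfolding K_def by (auto intro: inv_into_into)
  have "x \<in> (\<Union>y\<in>K. mball y e)" if "x \<in> S" for x
  proof -
    have "inv_into S f (f x) \<in> S" "f (inv_into S f (f x)) = f x"
      using that by (auto intro: inv_into_into f_inv_into_f)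
    then show ?thesis
      using that f(2) \<open>S \<subseteq> M\<close> unfolding K_def by auto
  qed
  then show "\<exists>K. finite K \<and> K \<subseteq> S \<and> S \<subseteq> (\<Union>y\<in>K. mball y e)"
    using \<open>K \<subseteq> S\<close> f(1) by (intro exI[of _ K]) (auto simp: K_def)
qed

section \<open>From endographs to cuts\<close>

text \<open>The point \<open>(x, \<alpha>)\<close> has a neighbour in the endograph of \<open>v\<close>, and the bound \<open>\<delta>\<close> is shared
  between the horizontal and the vertical displacement, so that the neighbour still has height at
  least \<open>\<beta>\<close>.\<close>

lemma H_end_less_imp_near_cut:
  assumes u: "u \<in> F1_USC" and v: "v \<in> F1_USC" and less: "H_end u v < \<delta>"
    and x: "x \<in> fcut u \<alpha>" and \<beta>: "0 < \<beta>" "\<beta> \<le> \<alpha> - \<delta>"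
  shows "\<exists>y\<in>fcut v \<beta>. dist x y < \<delta>"
proof -
  have "0 < \<delta>"
    using less H_end_nonneg[of u v] by linarith
  then have "\<alpha> \<le> u x" "0 \<le> \<alpha>"
    using x \<beta> by (auto simp: fcut_def)
  then have "(x, \<alpha>) \<in> endograph u"
    using F1_USC_range(2)[OF u, of x] by (simp add: endograph_def)
  then obtain q where "q \<in> endograph v" "sum_dist (x, \<alpha>) q < \<delta>"
    using H_end_less_imp[OF u v less] by blast
  then obtain y t where "t \<le> v y" and near: "dist x y + \<bar>\<alpha> - t\<bar> < \<delta>"
    by (cases q) (auto simp: endograph_def sum_dist_def)
  then have "\<beta> \<le> v y"
    using \<beta> zero_le_dist[of x y] by linarith
  then have "y \<in> fcut v \<beta>"
    using \<beta> by (simp add: fcut_def)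
  then show ?thesis
    using near by force
qed

lemma mtotally_bounded_imp_totally_bounded_cut_union:
  fixes U :: "('a::metric_space \<Rightarrow> real) set"
  assumes U: "U \<subseteq> F1_USCG" and tb: "Metric_space.mtotally_bounded F1_USCG H_end U"
    and \<alpha>: "\<alpha> \<in> {0<..1}"
  shows "totally_bounded (cut_union U \<alpha>)"
proof (rule totally_bounded_if_approximated)
  interpret Metric_space "F1_USCG :: ('a \<Rightarrow> real) set" H_end
    by (rule Metric_space_F1_USCG)
  fix e :: real assume "0 < e"
  \<comment> \<open>The bound by \<open>\<alpha>/2\<close> keeps the level \<open>\<alpha>/2 \<le> \<alpha> - \<delta>\<close> positive, where cuts are compact.\<close>
  define \<delta> where "\<delta> = min e (\<alpha> / 2)"
  have "0 < \<delta>"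
    using \<alpha> \<open>0 < e\<close> by (simp add: \<delta>_def)
  then obtain K where K: "finite K" "K \<subseteq> U" "U \<subseteq> (\<Union>v\<in>K. mball v \<delta>)"
    using tb[unfolded mtotally_bounded_def, rule_format, of \<delta>] by auto
  have "totally_bounded (\<Union>v\<in>K. fcut v (\<alpha> / 2))"
  proof (rule compact_imp_totally_bounded, rule compact_UN)
    show "compact (fcut v (\<alpha> / 2))" if "v \<in> K" for v
      using that K(2) U \<alpha> by (auto simp: F1_USCG_def)
  qed (fact K(1))
  moreover have "\<exists>y\<in>(\<Union>v\<in>K. fcut v (\<alpha> / 2)). dist x y < e" if x: "x \<in> cut_union U \<alpha>" for x
  proof -
    obtain u where u: "u \<in> U" "x \<in> fcut u \<alpha>"
      using x by (auto simp: cut_union_def)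
    then obtain v where v: "v \<in> K" "H_end u v < \<delta>"
      using K(3) by (auto simp: H_end_commute[of u])
    moreover have "\<alpha> / 2 \<le> \<alpha> - \<delta>"
      using min.cobounded2[of e "\<alpha> / 2"] by (simp add: \<delta>_def)
    moreover have "u \<in> F1_USC" "v \<in> F1_USC"
      using u v K(2) U by (auto simp: F1_USCG_def)
    ultimately obtain y where "y \<in> fcut v (\<alpha> / 2)" "dist x y < \<delta>"
      using H_end_less_imp_near_cut[of u v \<delta> x \<alpha> "\<alpha> / 2"] u(2) \<alpha>
      by auto
    then show ?thesis
      using v(1) by (auto simp: \<delta>_def)
  qed
  ultimately show "\<exists>T. totally_bounded T \<and> (\<forall>x\<in>cut_union U \<alpha>. \<exists>y\<in>T. dist x y < e)"
    by blast
qed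

section \<open>From cuts to endographs\<close>

text \<open>The levels start at \<open>k = 1\<close>: the cut at level 0 is the closure of the whole support, which
  finitely many balls of radius \<open>\<eta>\<close> need not cover.\<close>

definition fingerprint ::
    "'a::metric_space set \<Rightarrow> real \<Rightarrow> nat \<Rightarrow> ('a \<Rightarrow> real) \<Rightarrow> ('a \<times> nat) set" where
  "fingerprint F \<eta> N u = {(y, k). y \<in> F \<and> k \<in> {1..N} \<and> (\<exists>x\<in>fcut u (k / N). dist y x < \<eta>)}"

lemma finite_range_fingerprint:
  assumes "finite F"
  shows "finite (range (fingerprint F \<eta> N))"
proof (rule finite_subset)
  show "range (fingerprint F \<eta> N) \<subseteq> Pow (F \<times> {1..N})"
    by (auto simp: fingerprint_def)
  show "finite (Pow (F \<times> {1..N}))"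
    using assms by simp
qed

text \<open>A point \<open>(x, t)\<close> of the endograph of \<open>u\<close> is moved down to the level \<open>k/N\<close> just below
  \<open>t\<close>, at a cost of at most \<open>1/N\<close>, and then sideways into the cut of \<open>v\<close> at that level through the
  centre of a common ball, at a cost of at most \<open>2\<eta>\<close>. If \<open>k = 0\<close>, the downward move alone suffices.\<close>

lemma endograph_near_if_fingerprint_subset:
  fixes u v :: "'a::metric_space \<Rightarrow> real"
  assumes u: "u \<in> F1_USC" and v: "v \<in> F1_USC" and N: "0 < N" and "0 \<le> \<eta>"
    and cover: "\<And>x. x \<in> fcut u (1 / N) \<Longrightarrow> \<exists>y\<in>F. dist y x < \<eta>"
    and sub: "fingerprint F \<eta> N u \<subseteq> fingerprint F \<eta> N v"
    and p: "p \<in> endograph u"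
  shows "\<exists>q\<in>endograph v. sum_dist p q \<le> 2 * \<eta> + 1 / N"
proof -
  obtain x t where p_eq: "p = (x, t)" and t: "0 \<le> t" "t \<le> 1" "t \<le> u x"
    using p by (auto simp: endograph_def)
  define k where "k = nat \<lfloor>t * N\<rfloor>"
  have k: "k \<le> t * N" "t * N < k + 1"
    using t(1) by (auto simp: k_def) linarith
  have below: "k / N \<le> t" and above: "t \<le> k / N + 1 / N"
    using k N by (auto simp: field_simps)
  have "real k \<le> N"
    using k(1) t(2) mult_right_mono[of t 1 "real N"] by linarith
  then have "k \<le> N"
    by simp
  show ?thesis
  proof (cases "k = 0")
    case True
    have "(x, 0) \<in> endograph v"
      using F1_USC_range(1)[OF v] by (simp add: endograph_def)
    moreover have "sum_dist p (x, 0) \<le> 2 * \<eta> + 1 / N"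
      using above t(1) \<open>0 \<le> \<eta>\<close> True by (simp add: p_eq sum_dist_def)
    ultimately show ?thesis
      by blast
  next
    case False
    have x: "x \<in> fcut u (k / N)"
      using False N below t(3) by (simp add: fcut_def)
    have "1 / real N \<le> k / N"
      using False by (simp add: divide_right_mono)
    then have "x \<in> fcut u (1 / N)"
      using N below t(3) by (simp add: fcut_def)
    then obtain y where y: "y \<in> F" "dist y x < \<eta>"
      using cover by blast
    then have "(y, k) \<in> fingerprint F \<eta> N u"
      using x False \<open>k \<le> N\<close> by (auto simp: fingerprint_def)
    then obtain z where z: "z \<in> fcut v (k / N)" "dist y z < \<eta>"
      using sub by (auto simp: fingerprint_def)
    then have "(z, k / N) \<in> endograph v"
      using False N \<open>k \<le> N\<close> by (simp add: fcut_def endograph_def)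
    moreover have "sum_dist p (z, k / N) \<le> 2 * \<eta> + 1 / N"
      using dist_triangle3[of x z y] y(2) z(2) below above
      by (simp add: p_eq sum_dist_def)
    ultimately show ?thesis
      by blast
  qed
qed

lemma H_end_le_if_fingerprint_eq:
  fixes u v :: "'a::metric_space \<Rightarrow> real"
  assumes "u \<in> F1_USC" "v \<in> F1_USC" "0 < N" "0 \<le> \<eta>"
    and "\<And>x. x \<in> fcut u (1 / N) \<union> fcut v (1 / N) \<Longrightarrow> \<exists>y\<in>F. dist y x < \<eta>"
    and "fingerprint F \<eta> N u = fingerprint F \<eta> N v"
  shows "H_end u v \<le> 2 * \<eta> + 1 / N"
  using assms by (intro H_end_le endograph_near_if_fingerprint_subset[where F = F]) auto

lemma totally_bounded_cut_unions_imp_mtotally_bounded: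
  fixes U :: "('a::metric_space \<Rightarrow> real) set"
  assumes U: "U \<subseteq> F1_USCG" and tb: "\<And>\<alpha>. \<alpha> \<in> {0<..1} \<Longrightarrow> totally_bounded (cut_union U \<alpha>)"
  shows "Metric_space.mtotally_bounded F1_USCG H_end U"
proof (rule Metric_space.mtotally_bounded_if_finite_invariant[OF Metric_space_F1_USCG U])
  fix e :: real assume "0 < e"
  then obtain N :: nat where N: "0 < N" "1 / N < e / 2"
    using nat_approx_posE[of "e / 2"] half_gt_zero zero_less_Suc by blast
  have "totally_bounded (cut_union U (1 / N))"
    using N(1) by (intro tb) (simp add: divide_le_eq_1)
  then obtain F where F: "finite F" "cut_union U (1 / N) \<subseteq> (\<Union>y\<in>F. {x. dist y x < e / 4})"
    unfolding totally_bounded_metric using divide_pos_pos[OF \<open>0 < e\<close> zero_less_numeral] by blast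
  have "H_end u v < e"
    if uv: "u \<in> U" "v \<in> U" "fingerprint F (e / 4) N u = fingerprint F (e / 4) N v" for u v
  proof -
    have "H_end u v \<le> 2 * (e / 4) + 1 / N"
    proof (rule H_end_le_if_fingerprint_eq)
      show "u \<in> F1_USC" "v \<in> F1_USC"
        using uv U by (auto simp: F1_USCG_def)
      show "\<exists>y\<in>F. dist y x < e / 4" if "x \<in> fcut u (1 / N) \<union> fcut v (1 / N)" for x
        using that uv F(2) by (auto simp: cut_union_def)
    qed (use N \<open>0 < e\<close> uv in auto)
    also have "\<dots> < e"
      using N(2) by simp
    finally show ?thesis .
  qed
  moreover have "finite (fingerprint F (e / 4) N ` U)"
    using finite_range_fingerprint[OF F(1)] by (rule finite_subset[rotated]) auto
  ultimately show "\<exists>f :: ('a \<Rightarrow> real) \<Rightarrow> ('a \<times> nat) set. finite (f ` U) \<and>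
      (\<forall>u\<in>U. \<forall>v\<in>U. f u = f v \<longrightarrow> H_end u v < e)"
    by blast
qed

theorem theorem7p8:
  fixes U :: "('a::metric_space \<Rightarrow> real) set"
  assumes "U \<subseteq> F1_USCG"
  shows "Metric_space.mtotally_bounded F1_USCG H_end U
    \<longleftrightarrow> (\<forall>\<alpha>\<in>{0<..1}. totally_bounded (cut_union U \<alpha>))"
  using assms mtotally_bounded_imp_totally_bounded_cut_union
    totally_bounded_cut_unions_imp_mtotally_bounded by blast

end
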